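(* Suppose $u,v\in\mathbb{P}^*$ are such that there is a rearrangement $f:\mathbb{P}^*\to\mathbb{P}^*$ witnessing $u\sim v$. Then for any strictly increasing function $\iota:\mathbb{P}\to\mathbb{P}$ there is a rearrangement $g:\mathbb{P}^*\to\mathbb{P}^*$ witnessing $\iota(u)\sim\iota(v)$.
   Context: $\mathbb{P}$ is the positive integers; $\mathbb{P}^*$ the finite words over $\mathbb{P}$. Generalized factor order: $u\le w$ iff there is a factor $w'$ of $w$ (consecutive letters) with $|w'|=|u|$ and $u_i\le w'_i$ for all $i$. The weight of $w=w_1\cdots w_\ell$ is $t^\ell x^{w_1+\cdots+w_\ell}$; $u\sim v$ (Wilf equivalence) means $\sum_{w\ge u}\mathrm{wt}(w)=\sum_{w\ge v}\mathrm{wt}(w)$. A map $f:\mathbb{P}^*\to\mathbb{P}^*$ is a rearrangement if $f(w)$ is a rearrangement (permutation of the letters) of $w$ for all $w$. A weight-preserving bijection $f:\mathbb{P}^*\to\mathbb{P}^*$ witnesses $u\sim v$ if for all $w\in\mathbb{P}^*$: $u\le w\iff v\le f(w)$. A function $\iota:\mathbb{P}\to\mathbb{P}$ is extended to words letterwise: $\iota(u_1\cdots u_n)=\iota(u_1)\cdots\iota(u_n)$. *)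

theory Defs
  imports
    "HOL-Library.FuncSet"
    "HOL-Library.Multiset"
    "HOL-Library.Sublist"
    "HOL-Computational_Algebra.Polynomial"
begin

text \<open>
  Positive integers are natural numbers in \<open>{0<..}\<close>. Maps out of the positive integers or out of
  the words are total HOL functions of which only the restriction to the carrier matters.
\<close>

abbreviation PP :: "nat set" where
  "PP \<equiv> {0<..}"

abbreviation PP_words :: "nat list set" where
  "PP_words \<equiv> lists PP"

definition factor_le :: "nat list \<Rightarrow> nat list \<Rightarrow> bool" where
  "factor_le u w \<longleftrightarrow>
     (\<exists>w'. sublist w' w \<and> length w' = length u \<and> (\<forall>i<length u. u ! i \<le> w' ! i))"

text \<open>The monomial \<open>t ^ length w * x ^ sum_list w\<close>; \<open>t\<close> is the outer and \<open>x\<close> the inner variable.\<close>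

definition wt :: "nat list \<Rightarrow> int poly poly" where
  "wt w = monom (monom 1 (sum_list w)) (length w)"

definition is_rearrangement :: "(nat list \<Rightarrow> nat list) \<Rightarrow> bool" where
  "is_rearrangement f \<longleftrightarrow> f \<in> PP_words \<rightarrow> PP_words \<and> (\<forall>w\<in>PP_words. mset (f w) = mset w)"

text \<open>\<open>witnesses f u v\<close> includes that \<open>f\<close> is a weight-preserving bijection of the words; a
  rearrangement as such need not be bijective.\<close>

definition witnesses :: "(nat list \<Rightarrow> nat list) \<Rightarrow> nat list \<Rightarrow> nat list \<Rightarrow> bool" where
  "witnesses f u v \<longleftrightarrow>
     bij_betw f PP_words PP_words \<and>
     (\<forall>w\<in>PP_words. wt (f w) = wt w) \<and>
     (\<forall>w\<in>PP_words. factor_le u w \<longleftrightarrow> factor_le v (f w))"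

end

theory Submission imports Defs "HOL-Combinatorics.Permutations" begin

text \<open>
  Let \<open>l a\<close> be the largest \<open>k\<close> with \<open>\<iota> k \<le> a\<close>, and \<open>0\<close> if there is none. Then \<open>\<iota>(u) \<le> w\<close> iff
  \<open>u \<le> l(w)\<close>, where \<open>l(w)\<close> may contain zeros. As \<open>u\<close> has positive letters, an occurrence of \<open>u\<close>
  in \<open>l(w)\<close> lies in one of the zero-free blocks of \<open>l(w)\<close>, so applying \<open>f\<close> to each block turns
  occurrences of \<open>u\<close> into occurrences of \<open>v\<close>. This blockwise map is an injective rearrangement, and
  it lifts along \<open>l\<close>: choose, for each word \<open>s\<close> over the natural numbers, a permutation of positions
  realising the rearrangement of \<open>s\<close>, and permute \<open>w\<close> by the one chosen for \<open>l(w)\<close>. Injectivity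
  suffices because there are only finitely many words with given letters.
\<close>

lemma strict_mono_on_galois:
  fixes \<iota> :: "nat \<Rightarrow> nat"
  assumes mono: "strict_mono_on PP \<iota>"
  obtains l where "\<And>k a. 0 < k \<Longrightarrow> \<iota> k \<le> a \<longleftrightarrow> k \<le> l a"
proof -
  \<comment> \<open>This growth bound makes the sets \<open>K a\<close> below finite. The
    \<open>Suc\<close> allows for \<open>\<iota> 1 = 0\<close>.\<close>
  have ge: "k \<le> Suc (\<iota> k)" if "0 < k" for k
    using that
  proof (induction k)
    case (Suc k)
    show ?case
    proof (cases "k = 0")
      case False
      then have "\<iota> k < \<iota> (Suc k)"
        using mono by (auto simp: strict_mono_on_def)
      with Suc False show ?thesis by simp
    qed simp
  qed simp
  \<comment> \<open>The extra \<open>0\<close> keeps the set nonempty, so \<open>Max\<close> is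
    meaningful and is \<open>0\<close> when no positive \<open>k\<close> fits.\<close>
  define K where "K a = insert 0 {k. 0 < k \<and> \<iota> k \<le> a}" for a
  have "k \<le> Suc a" if "0 < k" "\<iota> k \<le> a" for k a
    using ge[OF that(1)] that(2) by simp
  then have "K a \<subseteq> {..Suc a}" for a
    by (auto simp: K_def)
  then have fin: "finite (K a)" for a
    using finite_subset by blast
  have "\<iota> k \<le> a \<longleftrightarrow> k \<le> Max (K a)" if "0 < k" for k a
  proof
    assume "\<iota> k \<le> a"
    with that fin show "k \<le> Max (K a)"
      by (auto simp: K_def intro!: Max_ge)
  next
    assume le: "k \<le> Max (K a)"
    have "Max (K a) \<in> K a"
      using fin by (intro Max_in) (auto simp: K_def)
    with le that have "0 < Max (K a)" "\<iota> (Max (K a)) \<le> a"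
      by (auto simp: K_def)
    moreover have "\<iota> k \<le> \<iota> (Max (K a))"
      using le that by (intro mono_onD[OF strict_mono_on_imp_mono_on[OF mono]]) auto
    ultimately show "\<iota> k \<le> a" by simp
  qed
  then show thesis by (rule that)
qed

lemma sublist_map_iff: "sublist s (map h w) \<longleftrightarrow> (\<exists>w'. sublist w' w \<and> s = map h w')"
proof
  assume "sublist s (map h w)"
  then obtain a b where "map h w = a @ s @ b"
    by (auto simp: sublist_def)
  then obtain wa ws wb where "w = wa @ ws @ wb" "s = map h ws"
    by (metis map_eq_append_conv)
  then show "\<exists>w'. sublist w' w \<and> s = map h w'"
    by (auto simp: sublist_def)
next
  assume "\<exists>w'. sublist w' w \<and> s = map h w'"
  then obtain a w' b where "w = a @ w' @ b" "s = map h w'"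
    by (auto simp: sublist_def)
  then have "map h w = map h a @ s @ map h b"
    by simp
  then show "sublist s (map h w)"
    unfolding sublist_def by blast
qed

lemma factor_le_map_iff:
  assumes "u \<in> PP_words" and "\<And>k a. 0 < k \<Longrightarrow> \<iota> k \<le> a \<longleftrightarrow> k \<le> l a"
  shows "factor_le (map \<iota> u) w \<longleftrightarrow> factor_le u (map l w)"
proof -
  have "0 < u ! i" if "i < length u" for i
    using assms(1) that by (auto simp: in_lists_conv_set)
  then have "(\<forall>i<length u. map \<iota> u ! i \<le> s ! i) \<longleftrightarrow> (\<forall>i<length u. u ! i \<le> map l s ! i)"
    if "length s = length u" for s
    using assms(2) that by simp
  then show ?thesis
    unfolding factor_le_def sublist_map_iff by (metis length_map)
qed

lemma sublist_append_Cons_notin: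
  assumes "x \<notin> set s"
  shows "sublist s (a @ x # r) \<longleftrightarrow> sublist s a \<or> sublist s r"
proof -
  \<comment> \<open>In an occurrence crossing the boundary, a nonempty \<open>s2\<close> would start
    with \<open>x\<close>; hence \<open>s2\<close> is empty.\<close>
  have suffix: "suffix s a" if "s = s1 @ s2" "suffix s1 a" "prefix s2 (x # r)" for s1 s2
    using that assms by (cases s2) auto
  have "sublist s a" if "prefix s (x # r)"
    using that assms by (cases s) auto
  then have "sublist s (x # r) \<Longrightarrow> sublist s a \<or> sublist s r"
    by (auto simp: sublist_Cons_right)
  then have "sublist s (a @ x # r) \<Longrightarrow> sublist s a \<or> sublist s r"
    unfolding sublist_append using suffix suffix_imp_sublist by blast
  moreover have "sublist s r \<Longrightarrow> sublist s (x # r)"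
    by (simp add: sublist_Cons_right)
  ultimately show ?thesis
    unfolding sublist_append by blast
qed

text \<open>A window dominating \<open>u\<close> has only positive letters, so it cannot contain the
  separating zero.\<close>

lemma factor_le_append_Cons_0:
  assumes "u \<in> PP_words"
  shows "factor_le u (a @ 0 # r) \<longleftrightarrow> factor_le u a \<or> factor_le u r"
proof -
  have "0 \<notin> set s" if "length s = length u" "\<forall>i<length u. u ! i \<le> s ! i" for s
    using that assms by (fastforce simp: in_lists_conv_set in_set_conv_nth)
  then show ?thesis
    unfolding factor_le_def using sublist_append_Cons_notin by metis
qed

text \<open>Zeros stay as separators and \<open>f\<close> acts on each maximal zero-free block,
  empty blocks included.\<close>

function map_blocks :: "(nat list \<Rightarrow> nat list) \<Rightarrow> nat list \<Rightarrow> nat list" where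
  "map_blocks f s = f (takeWhile ((\<noteq>) 0) s) @
     (case dropWhile ((\<noteq>) 0) s of [] \<Rightarrow> [] | x # r \<Rightarrow> x # map_blocks f r)"
  by pat_completeness auto
termination
proof (relation "measure (\<lambda>(f, s). length s)")
  fix s x r
  assume "dropWhile ((\<noteq>) (0::nat)) s = x # r"
  then show "((f, r), (f, s)) \<in> measure (\<lambda>(f, s). length s)" for f :: "nat list \<Rightarrow> nat list"
    using length_dropWhile_le[of "(\<noteq>) 0" s] by simp
qed simp

declare map_blocks.simps [simp del]

lemma PP_words_iff: "s \<in> PP_words \<longleftrightarrow> 0 \<notin> set s"
  by (auto simp: in_lists_conv_set intro: gr0I)

lemma map_blocks_PP: "s \<in> PP_words \<Longrightarrow> map_blocks f s = f s"
proof -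
  assume "s \<in> PP_words"
  then have "takeWhile ((\<noteq>) 0) s = s" "dropWhile ((\<noteq>) 0) s = []"
    by (auto simp: in_lists_conv_set takeWhile_eq_all_conv dropWhile_eq_Nil_conv)
  then show ?thesis by (subst map_blocks.simps) (simp only: list.case append_Nil2)
qed

lemma map_blocks_append_0:
  "a \<in> PP_words \<Longrightarrow> map_blocks f (a @ 0 # r) = f a @ 0 # map_blocks f r"
proof -
  assume "a \<in> PP_words"
  then have "\<And>x. x \<in> set a \<Longrightarrow> 0 \<noteq> x"
    by (auto simp: in_lists_conv_set)
  then have "takeWhile ((\<noteq>) 0) (a @ 0 # r) = a" "dropWhile ((\<noteq>) 0) (a @ 0 # r) = 0 # r"
    by simp_all
  then show ?thesis by (simp add: map_blocks.simps)
qed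

lemma blocks_cases:
  fixes s :: "nat list"
  obtains (PP) "s \<in> PP_words" | (zero) a r where "a \<in> PP_words" "s = a @ 0 # r"
  by (metis PP_words_iff split_list_first)

text \<open>Cutting at the first zero leaves a shorter rest; this mirrors the recursion of
  \<open>map_blocks\<close>.\<close>

lemma blocks_induct [case_names PP zero]:
  fixes s :: "nat list"
  assumes "\<And>s. s \<in> PP_words \<Longrightarrow> P s"
    and "\<And>a r. a \<in> PP_words \<Longrightarrow> P r \<Longrightarrow> P (a @ 0 # r)"
  shows "P s"
proof (induction s rule: length_induct)
  case (1 s)
  show ?case
    by (cases s rule: blocks_cases) (use 1 assms in auto)
qed

lemma mset_map_blocks:
  assumes "\<And>a. a \<in> PP_words \<Longrightarrow> mset (f a) = mset a"
  shows "mset (map_blocks f s) = mset s"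
  by (induction s rule: blocks_induct) (simp_all add: map_blocks_PP map_blocks_append_0 assms)

lemma append_Cons_0_eq_iff:
  assumes "a \<in> PP_words" "b \<in> PP_words"
  shows "a @ 0 # r = b @ 0 # t \<longleftrightarrow> a = b \<and> r = t"
  using assms
proof (induction a arbitrary: b)
  case Nil
  then show ?case by (cases b) auto
next
  case (Cons x a)
  then show ?case by (cases b) auto
qed

text \<open>Since \<open>f\<close> creates no zeros, the zeros of the image are exactly the
  separators. The image can thus be cut back into blocks, and each block is recovered by injectivity
  of \<open>f\<close>.\<close>

lemma inj_map_blocks:
  assumes PP: "f \<in> PP_words \<rightarrow> PP_words" and inj: "inj_on f PP_words"
  shows "inj (map_blocks f)"
proof -
  have no_zero: "f a \<noteq> f b @ 0 # t" if "a \<in> PP_words" for a b t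
  proof -
    have "f a \<in> PP_words"
      using PP that by blast
    then show ?thesis by (auto simp: PP_words_iff)
  qed
  have "s = t" if "map_blocks f s = map_blocks f t" for s t
    using that
  proof (induction s arbitrary: t rule: blocks_induct)
    case (PP s)
    show ?case
      by (cases t rule: blocks_cases)
        (use PP inj no_zero in \<open>auto simp: map_blocks_PP map_blocks_append_0 dest: inj_onD\<close>)
  next
    case (zero a r)
    show ?case
    proof (cases t rule: blocks_cases)
      case PP
      then show ?thesis
        using zero no_zero[of t a] by (metis map_blocks_PP map_blocks_append_0)
    next
      case (zero b t')
      have "f a \<in> PP_words" "f b \<in> PP_words"
        using PP \<open>a \<in> PP_words\<close> \<open>b \<in> PP_words\<close> by blast+
      then have "f a = f b" "map_blocks f r = map_blocks f t'"
        using zero.prems \<open>a \<in> PP_words\<close> zero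
        by (simp_all add: map_blocks_append_0 append_Cons_0_eq_iff)
      then show ?thesis
        using zero.IH inj zero \<open>a \<in> PP_words\<close> by (auto dest: inj_onD)
    qed
  qed
  then show ?thesis by (rule injI)
qed

text \<open>Both sides split into the same disjunction over blocks, and on a single block this is
  the assumption on \<open>f\<close>.\<close>

lemma factor_le_map_blocks_iff:
  assumes "u \<in> PP_words" "v \<in> PP_words"
    and "\<And>w. w \<in> PP_words \<Longrightarrow> factor_le u w \<longleftrightarrow> factor_le v (f w)"
  shows "factor_le u s \<longleftrightarrow> factor_le v (map_blocks f s)"
  by (induction s rule: blocks_induct)
    (simp_all add: map_blocks_PP map_blocks_append_0 factor_le_append_Cons_0 assms)

text \<open>As \<open>h\<close> may identify letters, \<open>F\<close> alone does not say where each
  letter of \<open>w\<close> goes; a permutation of positions chosen from \<open>map h w\<close>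
  does.\<close>

lemma lift_rearrangement:
  fixes F :: "'b list \<Rightarrow> 'b list" and h :: "'a \<Rightarrow> 'b"
  assumes inj: "inj F" and mset: "\<And>s. mset (F s) = mset s"
  obtains g where "inj g" "\<And>w. mset (g w) = mset w" "\<And>w. map h (g w) = F (map h w)"
proof -
  have "\<exists>p. p permutes {..<length s} \<and> permute_list p s = F s" for s
    by (rule mset_eq_permutation[OF mset]) blast
  then obtain p where p: "\<And>s. p s permutes {..<length s}" "\<And>s. permute_list (p s) s = F s"
    by metis
  define g where "g w = permute_list (p (map h w)) w" for w
  have perm: "p (map h w) permutes {..<length w}" for w
    using p(1)[of "map h w"] by simp
  have mset_g: "mset (g w) = mset w" for w
    unfolding g_def by (rule mset_permute_list[OF perm])
  have map_g: "map h (g w) = F (map h w)" for w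
    unfolding g_def p(2)[symmetric] by (simp add: permute_list_map[OF perm])
  have "inj g"
  proof (rule injI)
    fix w w'
    assume eq: "g w = g w'"
    \<comment> \<open>The image determines the projection because \<open>F\<close> is injective, so
      both words were permuted by the same permutation, which can be undone.\<close>
    then have "map h w = map h w'"
      using map_g inj by (metis injD)
    then have perm': "p (map h w) permutes {..<length w'}"
      and len: "length w = length w'"
      and eq': "permute_list (p (map h w)) w = permute_list (p (map h w)) w'"
      using perm[of w'] eq by (auto simp: g_def dest: map_eq_imp_length_eq)
    show "w = w'"
    proof (rule nth_equalityI[OF len])
      fix i
      assume "i < length w"
      \<comment> \<open>Entry \<open>j\<close> of the permuted list is entry \<open>i\<close> of the
        original.\<close>
      define j where "j = inv (p (map h w)) i"
      have j: "p (map h w) j = i"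
        unfolding j_def by (rule permutes_inverses(1)[OF perm[of w]])
      then have "j < length w"
        using \<open>i < length w\<close> permutes_in_image[OF perm[of w], of j] by simp
      then show "w ! i = w' ! i"
        using arg_cong[OF eq', of "\<lambda>xs. xs ! j"] j len
        by (simp add: permute_list_def)
    qed
  qed
  then show thesis
    using that mset_g map_g by blast
qed

lemma bij_betw_lists_of_rearrangement:
  fixes g :: "'a list \<Rightarrow> 'a list"
  assumes inj: "inj g" and mset: "\<And>w. mset (g w) = mset w"
  shows "bij_betw g (lists A) (lists A)"
proof -
  have "y \<in> g ` lists A" if "y \<in> lists A" for y
  proof -
    \<comment> \<open>The rearrangements of \<open>y\<close> form a finite set that \<open>g\<close>
      maps injectively into itself, hence onto itself.\<close>
    have "g ` {w. mset w = mset y} = {w. mset w = mset y}"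
    proof (rule endo_inj_surj)
      show "finite {w. mset w = mset y}"
      proof (rule finite_subset)
        show "{w. mset w = mset y} \<subseteq> {w. set w \<subseteq> set y \<and> length w = length y}"
          by (auto dest: mset_eq_setD mset_eq_length)
      qed (simp add: finite_lists_length_eq)
    qed (use inj mset in \<open>auto intro: inj_on_subset\<close>)
    then obtain w where "mset w = mset y" "y = g w"
      by blast
    with that show ?thesis
      by (auto simp: in_lists_conv_set dest: mset_eq_setD)
  qed
  moreover have "g w \<in> lists A" if "w \<in> lists A" for w
    using that mset_eq_setD[OF mset[of w]] by (simp add: in_lists_conv_set)
  ultimately show ?thesis
    using inj by (auto simp: bij_betw_def intro: inj_on_subset)
qed

lemma wt_mset_cong: "mset w = mset w' \<Longrightarrow> wt w = wt w'"
  unfolding wt_def by (metis mset_eq_length sum_mset_sum_list)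

theorem theorem4p4:
  fixes u v :: "nat list" and \<iota> :: "nat \<Rightarrow> nat"
  assumes "u \<in> PP_words" and "v \<in> PP_words"
    and "\<exists>f. is_rearrangement f \<and> witnesses f u v"
    and "\<iota> \<in> PP \<rightarrow> PP" and "strict_mono_on PP \<iota>"
  shows "\<exists>g. is_rearrangement g \<and> witnesses g (map \<iota> u) (map \<iota> v)"
proof -
  obtain f where f: "f \<in> PP_words \<rightarrow> PP_words" "inj_on f PP_words"
      "\<And>w. w \<in> PP_words \<Longrightarrow> mset (f w) = mset w"
      "\<And>w. w \<in> PP_words \<Longrightarrow> factor_le u w \<longleftrightarrow> factor_le v (f w)"
    using assms(3) by (auto simp: is_rearrangement_def witnesses_def bij_betw_def)
  obtain l where l: "\<And>k a. 0 < k \<Longrightarrow> \<iota> k \<le> a \<longleftrightarrow> k \<le> l a"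
    using strict_mono_on_galois[OF assms(5)] by blast
  obtain g where g: "inj g" "\<And>w. mset (g w) = mset w"
      "\<And>w. map l (g w) = map_blocks f (map l w)"
    using lift_rearrangement[OF inj_map_blocks[OF f(1,2)] mset_map_blocks[OF f(3)]] by blast
  have bij: "bij_betw g PP_words PP_words"
    by (rule bij_betw_lists_of_rearrangement[OF g(1,2)])
  \<comment> \<open>Chain: \<open>u\<close> below \<open>map l w\<close>, then \<open>v\<close>
    below \<open>map_blocks f (map l w)\<close>, which is \<open>map l (g w)\<close>; the adjunction
    translates both ends.\<close>
  have "factor_le (map \<iota> u) w \<longleftrightarrow> factor_le (map \<iota> v) (g w)" for w
    by (simp add: factor_le_map_iff[OF assms(1) l] factor_le_map_iff[OF assms(2) l] g(3)
        factor_le_map_blocks_iff[OF assms(1,2) f(4)])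
  then have "witnesses g (map \<iota> u) (map \<iota> v)"
    using bij wt_mset_cong[OF g(2)] by (simp add: witnesses_def)
  moreover have "is_rearrangement g"
    unfolding is_rearrangement_def using bij_betw_imp_funcset[OF bij] g(2) by blast
  ultimately show ?thesis by blast
qed

end
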